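(* Let $d\ge 1$ and let $A\subseteq[0,\infty)$ be an arbitrary set with at least two elements. Then there is a residual set $R\subseteq\Omega$ such that for every configuration $\omega\in R$ there are no more than $4d^2$ distinct geodesic rays in $\mathbb{Z}^d$, i.e. there is no family of $4d^2+1$ pairwise distinct geodesic rays.
   Context: Let $E$ be the set of nearest neighbor edges of the lattice $\mathbb{Z}^d$ (edges join lattice points at $\ell_1$-distance $1$). The space of configurations is $\Omega=\prod_{e\in E}A$, where $A$ carries the subspace topology inherited from $\mathbb{R}$ and $\Omega$ the product topology. A subset of $\Omega$ is residual if its complement is meager, i.e. a countable union of nowhere dense sets. For a configuration $\omega=(\tau(e))_{e\in E}\in\Omega$, $\tau(e)$ is the passage time of the edge $e$; for a finite path $\Gamma$ of consecutive edges, $\tau(\Gamma)=\sum_{e\in\Gamma}\tau(e)$. For lattice points $x,y$, $T(x,y)=\inf_\Gamma\tau(\Gamma)$, the infimum being over all finite paths $\Gamma$ connecting $x$ to $y$. A geodesic between $x$ and $y$ is a finite path $\Gamma$ connecting $x$ to $y$ with $\tau(\Gamma)=T(x,y)$. A geodesic ray is a self-avoiding path of infinitely many edges indexed by $\mathbb{N}$ (infinite in one direction only, with a starting vertex) each of whose finite subpaths is a geodesic between its endpoints. Two geodesic rays are called distinct if they share only finitely many edges. *)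

theory Defs
  imports "HOL-Analysis.Analysis"
begin

section \<open>Baire category in abstract topologies\<close>

definition nowhere_dense_in :: "'a topology \<Rightarrow> 'a set \<Rightarrow> bool" where
  "nowhere_dense_in X S \<longleftrightarrow> S \<subseteq> topspace X \<and> X interior_of (X closure_of S) = {}"

definition meager_in :: "'a topology \<Rightarrow> 'a set \<Rightarrow> bool" where
  "meager_in X S \<longleftrightarrow> (\<exists>N :: nat \<Rightarrow> 'a set. (\<forall>n. nowhere_dense_in X (N n)) \<and> S = (\<Union>n. N n))"

definition residual_in :: "'a topology \<Rightarrow> 'a set \<Rightarrow> bool" where
  "residual_in X R \<longleftrightarrow> R \<subseteq> topspace X \<and> meager_in X (topspace X - R)"

section \<open>The lattice and its configurations\<close>

text \<open>
  The lattice of dimension \<open>CARD('d)\<close> is the type \<open>int ^ 'd\<close>; since \<open>'d\<close> is a nonempty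
  finite type, all dimensions at least 1 are covered.  Edges are undirected, hence
  represented by two-element sets of vertices.
\<close>

definition adjacent :: "int ^ 'd \<Rightarrow> int ^ 'd \<Rightarrow> bool" where
  "adjacent x y \<longleftrightarrow> (\<Sum>i\<in>UNIV. \<bar>x $ i - y $ i\<bar>) = 1"

definition lattice_edges :: "(int ^ 'd) set set" where
  "lattice_edges = {{x, y} |x y. adjacent x y}"

type_synonym 'd config = "(int ^ 'd) set \<Rightarrow> real"

text \<open>The points of this space are the extensional functions in \<open>PiE lattice_edges (\<lambda>_. A)\<close>.\<close>

definition config_space :: "real set \<Rightarrow> ('d::finite) config topology" where
  "config_space A = product_topology (\<lambda>_. top_of_set A) lattice_edges"

section \<open>Paths, passage times and geodesics\<close>

text \<open>
  A finite path is given by the nonempty list of its consecutive vertices.  It may repeat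
  vertices and edges (edges are then counted with multiplicity), and the one-vertex list is
  the path without edges.
\<close>

definition lattice_path :: "int ^ 'd \<Rightarrow> int ^ 'd \<Rightarrow> (int ^ 'd) list \<Rightarrow> bool" where
  "lattice_path x y p \<longleftrightarrow> p \<noteq> [] \<and> hd p = x \<and> last p = y \<and> successively adjacent p"

definition path_edges :: "(int ^ 'd) list \<Rightarrow> (int ^ 'd) set list" where
  "path_edges p = map (\<lambda>(u, v). {u, v}) (zip p (tl p))"

definition path_time :: "('d::finite) config \<Rightarrow> (int ^ 'd) list \<Rightarrow> real" where
  "path_time \<omega> p = (\<Sum>e\<leftarrow>path_edges p. \<omega> e)"

text \<open>
  For \<open>\<omega>\<close> with nonnegative values, the set below is nonempty and bounded below by 0, so that
  this is the genuine infimum.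
\<close>

definition passage_time :: "('d::finite) config \<Rightarrow> int ^ 'd \<Rightarrow> int ^ 'd \<Rightarrow> real" where
  "passage_time \<omega> x y = (INF p\<in>{p. lattice_path x y p}. path_time \<omega> p)"

definition geodesic :: "('d::finite) config \<Rightarrow> int ^ 'd \<Rightarrow> int ^ 'd \<Rightarrow> (int ^ 'd) list \<Rightarrow> bool" where
  "geodesic \<omega> x y p \<longleftrightarrow> lattice_path x y p \<and> path_time \<omega> p = passage_time \<omega> x y"

text \<open>A ray is given by the sequence of its vertices, \<open>\<gamma> 0\<close> being the starting vertex.\<close>

definition geodesic_ray :: "('d::finite) config \<Rightarrow> (nat \<Rightarrow> int ^ 'd) \<Rightarrow> bool" where
  "geodesic_ray \<omega> \<gamma> \<longleftrightarrow>
     inj \<gamma> \<and> (\<forall>n. adjacent (\<gamma> n) (\<gamma> (Suc n))) \<and>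
     (\<forall>m n. m \<le> n \<longrightarrow> geodesic \<omega> (\<gamma> m) (\<gamma> n) (map \<gamma> [m..<Suc n]))"

definition ray_edges :: "(nat \<Rightarrow> int ^ 'd) \<Rightarrow> (int ^ 'd) set set" where
  "ray_edges \<gamma> = range (\<lambda>n. {\<gamma> n, \<gamma> (Suc n)})"

definition distinct_rays :: "(nat \<Rightarrow> int ^ 'd) \<Rightarrow> (nat \<Rightarrow> int ^ 'd) \<Rightarrow> bool" where
  "distinct_rays \<gamma> \<gamma>' \<longleftrightarrow> finite (ray_edges \<gamma> \<inter> ray_edges \<gamma>')"

end

theory Submission
  imports Defs
begin

text \<open>
  Let \<open>a < b\<close> be two elements of \<open>A\<close>.  Whatever the values in a box of radius \<open>n\<close>, extend
  them to a box of radius \<open>M\<close> by values close to \<open>a\<close> on the coordinate axes (the highways) and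
  close to \<open>b\<close> elsewhere, where \<open>n \<lless> K \<lless> M\<close>.  A geodesic from the small box to the boundary of
  the large one must touch some half-axis beyond distance \<open>K\<close>, since otherwise it gains nothing
  from the highways on the long way out.  It cannot have joined this half-axis only beyond
  distance \<open>K\<close>, since following it from distance \<open>n\<close> on would have been quicker; and having
  joined it before, it follows it.  So it uses the highway edge at distance \<open>K\<close>.
  Hence generically, for every \<open>n\<close>, all geodesic rays starting in the \<open>n\<close>-box use one of \<open>2d\<close>
  edges not contained in that box.  If the box contains the starting points and all pairwise
  common edges of a family of pairwise distinct rays, the pigeonhole principle shows that there
  are at most \<open>2d \<le> 4d\<^sup>2\<close> of them.

  Lower bounds for passage times come from potentials whose increment along each
  edge is at most its passage time.
\<close>

section \<open>Boxes and adjacency\<close>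

definition lbox :: "int \<Rightarrow> (int ^ 'd) set" where
  "lbox n = {x. \<forall>i. \<bar>x $ i\<bar> \<le> n}"

lemma finite_lbox: "finite (lbox n :: (int ^ 'd::finite) set)"
proof (rule finite_subset)
  show "lbox n \<subseteq> vec_lambda ` (PiE (UNIV :: 'd set) (\<lambda>_. {-n..n}))"
  proof
    fix x :: "int ^ 'd" assume "x \<in> lbox n"
    then have "vec_nth x \<in> PiE UNIV (\<lambda>_. {-n..n})"
      by (auto simp: lbox_def abs_le_iff minus_le_iff)
    then show "x \<in> vec_lambda ` (PiE UNIV (\<lambda>_. {-n..n}))"
      by (metis imageI vec_nth_inverse)
  qed
qed (intro finite_imageI finite_PiE, auto)

lemma lbox_mono: "m \<le> n \<Longrightarrow> lbox m \<subseteq> lbox n"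
  by (auto simp: lbox_def intro: order_trans)

lemma ex_lbox_superset:
  assumes "finite S"
  shows "\<exists>n\<ge>n0. S \<subseteq> (lbox n :: (int ^ 'd::finite) set)"
  using assms
proof (induction S)
  case (insert x S)
  then obtain n where n: "n \<ge> n0" "S \<subseteq> lbox n" by blast
  let ?m = "max n (\<Sum>i\<in>UNIV. \<bar>x $ i\<bar>)"
  have "\<bar>x $ i\<bar> \<le> (\<Sum>i\<in>UNIV. \<bar>x $ i\<bar>)" for i
    by (rule member_le_sum) auto
  then have "x \<in> lbox ?m" by (auto simp: lbox_def intro: le_max_iff_disj[THEN iffD2])
  moreover have "S \<subseteq> lbox ?m" using n lbox_mono[of n ?m] by auto
  ultimately show ?case using n by (intro exI[of _ ?m]) auto
qed auto

lemma adjacent_cases: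
  fixes u v :: "int ^ 'd::finite"
  assumes "adjacent u v"
  obtains i where "\<bar>v $ i - u $ i\<bar> = 1" "\<And>j. j \<noteq> i \<Longrightarrow> v $ j = u $ j"
proof -
  have s: "(\<Sum>i\<in>UNIV. \<bar>u $ i - v $ i\<bar>) = 1" using assms by (simp add: adjacent_def)
  then have "\<exists>i. u $ i \<noteq> v $ i" by (metis (no_types, lifting) abs_0 diff_self sum.neutral zero_neq_one)
  then obtain i where i: "u $ i \<noteq> v $ i" by blast
  have e: "(\<Sum>i\<in>UNIV. \<bar>u $ i - v $ i\<bar>) = \<bar>u $ i - v $ i\<bar> + (\<Sum>k\<in>UNIV - {i}. \<bar>u $ k - v $ k\<bar>)"
    by (rule sum.remove) auto
  have nn: "(\<Sum>k\<in>UNIV - {i}. \<bar>u $ k - v $ k\<bar>) \<ge> 0" by (rule sum_nonneg) auto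
  have z: "(\<Sum>k\<in>UNIV - {i}. \<bar>u $ k - v $ k\<bar>) = 0" using s e nn i by linarith
  have "\<bar>u $ j - v $ j\<bar> = 0" if "j \<noteq> i" for j
    using z that by (subst (asm) sum_nonneg_eq_0_iff) auto
  with that[of i] s e z show ?thesis by fastforce
qed

lemma adjacentI:
  fixes u v :: "int ^ 'd::finite"
  assumes "\<bar>v $ i - u $ i\<bar> = 1" "\<And>j. j \<noteq> i \<Longrightarrow> v $ j = u $ j"
  shows "adjacent u v"
proof -
  have "(\<Sum>k\<in>UNIV. \<bar>u $ k - v $ k\<bar>) = (\<Sum>k\<in>UNIV. if k = i then 1 else 0)"
    by (rule sum.cong) (use assms in auto)
  then show ?thesis by (simp add: adjacent_def)
qed

lemma adjacent_axis:
  "\<bar>s - t\<bar> = 1 \<Longrightarrow> adjacent (axis j s) (axis j t :: int ^ 'd::finite)"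
  by (rule adjacentI[of _ j]) (auto simp: axis_def)

lemma lattice_edgesI: "adjacent u v \<Longrightarrow> {u, v} \<in> lattice_edges"
  by (auto simp: lattice_edges_def)

section \<open>Paths and rays\<close>

lemma path_edges_snoc:
  "p \<noteq> [] \<Longrightarrow> path_edges (p @ [w]) = path_edges p @ [{last p, w}]"
proof (induction p)
  case (Cons a p)
  then show ?case by (cases p) (auto simp: path_edges_def)
qed simp

lemma path_time_snoc: "p \<noteq> [] \<Longrightarrow> path_time \<omega> (p @ [w]) = path_time \<omega> p + \<omega> {last p, w}"
  by (simp add: path_time_def path_edges_snoc)

lemma path_time_ray:
  assumes "m \<le> n"
  shows "path_time \<omega> (map \<gamma> [m..<Suc n]) = (\<Sum>k=m..<n. \<omega> {\<gamma> k, \<gamma> (Suc k)})"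
  using assms
proof (induction n rule: dec_induct)
  case base
  then show ?case by (simp add: path_time_def path_edges_def)
next
  case (step n)
  have "map \<gamma> [m..<Suc (Suc n)] = map \<gamma> [m..<Suc n] @ [\<gamma> (Suc n)]" using step by simp
  moreover have "last (map \<gamma> [m..<Suc n]) = \<gamma> n" "map \<gamma> [m..<Suc n] \<noteq> []" using step by auto
  ultimately show ?case using step path_time_snoc[of "map \<gamma> [m..<Suc n]" \<omega> "\<gamma> (Suc n)"] by simp
qed

lemma path_edges_in_lattice:
  "successively adjacent p \<Longrightarrow> set (path_edges p) \<subseteq> lattice_edges"
proof (induction p rule: induct_list012)
  case (3 x y zs)
  then show ?case by (auto simp: path_edges_def intro: lattice_edgesI)
qed (auto simp: path_edges_def)

section \<open>Upper and lower bounds for passage times\<close>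

text \<open>Competing paths are built edge by edge through this relation, so that only an upper
  bound for the time is carried along and no vertex list has to be named.\<close>

definition reach :: "('d::finite) config \<Rightarrow> int ^ 'd \<Rightarrow> int ^ 'd \<Rightarrow> real \<Rightarrow> bool" where
  "reach \<omega> u v c \<longleftrightarrow> (\<exists>p. lattice_path u v p \<and> path_time \<omega> p \<le> c)"

lemma reach_refl: "reach \<omega> u u 0"
  unfolding reach_def by (rule exI[of _ "[u]"]) (simp add: lattice_path_def path_time_def path_edges_def)

lemma reach_step:
  assumes "reach \<omega> u v c" "adjacent v w" "c + \<omega> {v, w} \<le> c'"
  shows "reach \<omega> u w c'"
proof -
  obtain p where p: "lattice_path u v p" "path_time \<omega> p \<le> c"
    using assms by (auto simp: reach_def)
  then have "lattice_path u w (p @ [w])"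
    using assms(2) by (auto simp: lattice_path_def successively_append_iff)
  moreover have "path_time \<omega> (p @ [w]) \<le> c'"
    using p assms(3) path_time_snoc[of p \<omega> w] by (auto simp: lattice_path_def)
  ultimately show ?thesis by (auto simp: reach_def)
qed

text \<open>Greedy walk: each step moves one coordinate of \<open>u\<close> towards its value at
  \<open>v\<close>, hence never leaves the cuboid. Sides with \<open>lo i = hi i\<close> are
  allowed, so faces of a box are covered.\<close>

lemma reach_cuboid:
  fixes u v :: "int ^ 'd::finite"
  assumes "reach \<omega> x u c" "\<And>i. lo i \<le> u $ i \<and> u $ i \<le> hi i" "\<And>i. lo i \<le> v $ i \<and> v $ i \<le> hi i"
    and B: "\<And>p q. adjacent p q \<Longrightarrow> (\<And>i. lo i \<le> p $ i \<and> p $ i \<le> hi i) \<Longrightarrow>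
              (\<And>i. lo i \<le> q $ i \<and> q $ i \<le> hi i) \<Longrightarrow> \<omega> {p, q} \<le> B"
  shows "reach \<omega> x v (c + B * real_of_int (\<Sum>i\<in>UNIV. \<bar>u $ i - v $ i\<bar>))"
  using assms(1-2)
proof (induction "nat (\<Sum>i\<in>UNIV. \<bar>u $ i - v $ i\<bar>)" arbitrary: u c rule: less_induct)
  case less
  show ?case
  proof (cases "u = v")
    case False
    then obtain i where i: "u $ i \<noteq> v $ i" by (auto simp: vec_eq_iff)
    define w where "w = u + axis i (sgn (v $ i - u $ i))"
    have wi: "w $ i = u $ i + sgn (v $ i - u $ i)" and wj: "\<And>j. j \<noteq> i \<Longrightarrow> w $ j = u $ j"
      by (auto simp: w_def axis_def)
    have adj: "adjacent u w" by (rule adjacentI[of _ i]) (use wi wj i in \<open>auto simp: sgn_if\<close>)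
    have inw: "lo j \<le> w $ j \<and> w $ j \<le> hi j" for j
      using less.prems(2)[of j] assms(3)[of j] wi wj[of j] by (cases "j = i") (auto simp: sgn_if)
    have s: "(\<Sum>k\<in>UNIV. \<bar>u $ k - v $ k\<bar>) = (\<Sum>k\<in>UNIV. \<bar>w $ k - v $ k\<bar>) + 1"
    proof -
      have "(\<Sum>k\<in>UNIV. \<bar>u $ k - v $ k\<bar>) = (\<Sum>k\<in>UNIV. \<bar>w $ k - v $ k\<bar> + (if k = i then 1 else 0))"
        by (rule sum.cong) (use wi wj i in \<open>auto simp: sgn_if\<close>)
      then show ?thesis by (simp add: sum.distrib)
    qed
    have "(\<Sum>k\<in>UNIV. \<bar>w $ k - v $ k\<bar>) \<ge> 0" by (rule sum_nonneg) auto
    then have lt: "nat (\<Sum>k\<in>UNIV. \<bar>w $ k - v $ k\<bar>) < nat (\<Sum>k\<in>UNIV. \<bar>u $ k - v $ k\<bar>)"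
      using s by linarith
    have "reach \<omega> x w (c + B)"
      by (rule reach_step[OF less.prems(1) adj]) (use B[OF adj] less.prems(2) inw in auto)
    from less.hyps[OF lt this inw] show ?thesis by (simp add: s algebra_simps)
  qed (use less.prems in simp)
qed

lemma reach_axis:
  fixes \<sigma> :: int
  assumes "reach \<omega> x (axis j (\<sigma> * t)) c" "\<bar>\<sigma>\<bar> = 1" "t \<le> s"
  shows "reach \<omega> x (axis j (\<sigma> * s)) (c + (\<Sum>r\<in>{t..<s}. \<omega> {axis j (\<sigma> * r), axis j (\<sigma> * (r + 1))}))"
  using assms(3)
proof (induction s rule: int_ge_induct)
  case base
  then show ?case using assms by simp
next
  case (step s)
  have "{t..<s + 1} = insert s {t..<s}" using step by auto
  moreover have "adjacent (axis j (\<sigma> * s)) (axis j (\<sigma> * (s + 1)))"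
    by (rule adjacent_axis) (use assms in \<open>auto simp: algebra_simps\<close>)
  ultimately show ?case by (intro reach_step[OF step(2)]) auto
qed

text \<open>The infimum in \<open>passage_time\<close> is a lower bound for the path times only if
  these are bounded below; nonnegativity on the lattice edges supplies the bound 0.\<close>

lemma geodesic_ray_time_le:
  assumes nn: "\<And>e. e \<in> lattice_edges \<Longrightarrow> 0 \<le> \<omega> e"
    and "geodesic_ray \<omega> \<gamma>" "m \<le> n" "reach \<omega> (\<gamma> m) (\<gamma> n) c"
  shows "(\<Sum>k=m..<n. \<omega> {\<gamma> k, \<gamma> (Suc k)}) \<le> c"
proof -
  obtain p where p: "lattice_path (\<gamma> m) (\<gamma> n) p" "path_time \<omega> p \<le> c"
    using assms(4) by (auto simp: reach_def)
  have "0 \<le> path_time \<omega> q" if "lattice_path (\<gamma> m) (\<gamma> n) q" for q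
    unfolding path_time_def
    by (rule sum_list_nonneg)
      (use that path_edges_in_lattice nn in \<open>auto simp: lattice_path_def\<close>)
  then have "passage_time \<omega> (\<gamma> m) (\<gamma> n) \<le> path_time \<omega> p"
    unfolding passage_time_def using p by (intro cINF_lower bdd_belowI2[of _ 0]) auto
  moreover have "path_time \<omega> (map \<gamma> [m..<Suc n]) = passage_time \<omega> (\<gamma> m) (\<gamma> n)"
    using assms by (auto simp: geodesic_ray_def geodesic_def)
  ultimately show ?thesis using p path_time_ray[OF assms(3), of \<omega> \<gamma>] by simp
qed

text \<open>Telescoping. The edge condition is asked only for steps that the ray takes, so a
  potential may violate it at edges or vertices that the ray is assumed to avoid.\<close>

lemma potential_le_time:
  fixes \<phi> :: "int ^ 'd::finite \<Rightarrow> real"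
  assumes "m \<le> n"
    and "\<And>k. m \<le> k \<Longrightarrow> k < n \<Longrightarrow> \<phi> (\<gamma> (Suc k)) - \<phi> (\<gamma> k) \<le> \<omega> {\<gamma> k, \<gamma> (Suc k)}"
  shows "\<phi> (\<gamma> n) - \<phi> (\<gamma> m) \<le> (\<Sum>k=m..<n. \<omega> {\<gamma> k, \<gamma> (Suc k)})"
proof -
  have "\<phi> (\<gamma> n) - \<phi> (\<gamma> m) = (\<Sum>k=m..<n. \<phi> (\<gamma> (Suc k)) - \<phi> (\<gamma> k))"
    using sum_Suc_diff'[OF assms(1), of "\<lambda>k. \<phi> (\<gamma> k)"] by simp
  also have "\<dots> \<le> (\<Sum>k=m..<n. \<omega> {\<gamma> k, \<gamma> (Suc k)})"
    by (rule sum_mono) (use assms(2) in auto)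
  finally show ?thesis .
qed

section \<open>Highways along the axes\<close>

definition gate :: "int \<Rightarrow> 'd \<Rightarrow> int \<Rightarrow> (int ^ 'd::finite) set" where
  "gate K j \<sigma> = {axis j (\<sigma> * K), axis j (\<sigma> * (K + 1))}"

lemma axis_in_lbox [simp]: "0 \<le> m \<Longrightarrow> axis j s \<in> lbox m \<longleftrightarrow> \<bar>s\<bar> \<le> m"
  by (auto simp: lbox_def axis_def)

text \<open>Reaching a highway from inside the small box takes at most
  \<open>2 * n * CARD('d)\<close> edges of time at most \<open>C\<close>. By \<open>K_large\<close>,
  the gain \<open>\<beta> - \<alpha>\<close> per highway edge repays this detour before distance
  \<open>K\<close>. By \<open>M_large\<close> it still does so on the way out to \<open>M\<close>,
  after a loss of \<open>\<beta> * K * CARD('d)\<close> in the potential and of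
  \<open>\<beta>' - \<beta>\<close> on each of at most \<open>CARD('d) * M\<close> edges inside a
  face.\<close>

locale highways =
  fixes \<omega> :: "('d::finite) config" and n K M :: int and C \<alpha> \<beta> \<beta>' :: real
  assumes nonneg: "e \<in> lattice_edges \<Longrightarrow> 0 \<le> \<omega> e"
    and scales: "0 \<le> n" "n \<le> K" "K < M"
    and levels: "0 \<le> C" "0 \<le> \<alpha>" "\<alpha> < \<beta>" "\<beta> \<le> \<beta>'"
    and inner: "adjacent u v \<Longrightarrow> u \<in> lbox n \<Longrightarrow> v \<in> lbox n \<Longrightarrow> \<omega> {u, v} \<le> C"
    and outer: "adjacent u v \<Longrightarrow> u \<in> lbox M \<Longrightarrow> v \<in> lbox M \<Longrightarrow> \<not> (u \<in> lbox n \<and> v \<in> lbox n) \<Longrightarrow>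
      \<omega> {u, v} \<le> \<beta>'"
    and slow: "adjacent u v \<Longrightarrow> u \<in> lbox M \<Longrightarrow> v \<in> lbox M \<Longrightarrow> \<not> (u \<in> lbox n \<and> v \<in> lbox n) \<Longrightarrow>
      \<forall>j s t. {u, v} \<noteq> {axis j s, axis j t} \<Longrightarrow> \<beta> \<le> \<omega> {u, v}"
    and fast: "adjacent (axis j s) (axis j t) \<Longrightarrow> axis j s \<in> lbox M \<Longrightarrow> axis j t \<in> lbox M \<Longrightarrow>
      \<not> (axis j s \<in> lbox n \<and> axis j t \<in> lbox n) \<Longrightarrow> \<omega> {axis j s, axis j t} \<le> \<alpha>"
    and K_large: "C * (2 * n * CARD('d)) < (\<beta> - \<alpha>) * (K - n)"
    and M_large: "C * (2 * n * CARD('d)) + \<beta> * K * CARD('d) < (\<beta> - \<alpha> - (\<beta>' - \<beta>) * CARD('d)) * M"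
begin

lemma fast_axis:
  assumes "\<bar>\<sigma>\<bar> = 1" "n \<le> r" "r < M"
  shows "\<omega> {axis j (\<sigma> * r), axis j (\<sigma> * (r + 1))} \<le> \<alpha>"
proof (rule fast)
  show "adjacent (axis j (\<sigma> * r)) (axis j (\<sigma> * (r + 1)))"
    by (rule adjacent_axis) (use assms in \<open>auto simp: algebra_simps\<close>)
qed (use assms scales in \<open>auto simp: abs_mult\<close>)

text \<open>Every path within the big box from one highway vertex to another one further out crosses
  all hyperplanes in between; crossing them on the highway is strictly optimal.\<close>

lemma gate_used:
  assumes "geodesic_ray \<omega> \<gamma>" "\<bar>\<sigma>\<bar> = 1" "k0 \<le> k1" "\<And>k. k \<le> k1 \<Longrightarrow> \<gamma> k \<in> lbox M"
    and "\<gamma> k0 = axis j (\<sigma> * t)" "n \<le> t" "t \<le> K" "\<gamma> k1 = axis j (\<sigma> * s)" "K < s"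
  shows "gate K j \<sigma> \<in> ray_edges \<gamma>"
proof (rule ccontr)
  assume no: "gate K j \<sigma> \<notin> ray_edges \<gamma>"
  have \<sigma>: "\<sigma> = 1 \<or> \<sigma> = -1" using assms(2) by auto
  \<comment> \<open>\<open>c\<close> is the true highway time except at the gate, where
    \<open>\<beta>\<close> is charged: a ray avoiding the gate can cross there only off the
    highway.\<close>
  define h where "h r = \<omega> {axis j (\<sigma> * r), axis j (\<sigma> * (r + 1))}" for r
  define c where "c r = (if r = K then \<beta> else h r)" for r
  define \<phi> :: "int ^ 'd \<Rightarrow> real" where "\<phi> u = (\<Sum>r\<in>{t..<\<sigma> * u $ j}. c r)" for u
  have h0: "0 \<le> h r" for r
    unfolding h_def by (intro nonneg lattice_edgesI adjacent_axis) (use \<sigma> in auto)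
  have h\<alpha>: "h r \<le> \<alpha>" if "n \<le> r" "r < M" for r
    unfolding h_def using fast_axis[OF assms(2)] that by auto
  have c0: "0 \<le> c r" for r using h0 levels by (auto simp: c_def)
  have step: "\<phi> v - \<phi> u \<le> \<omega> {u, v}"
    if uv: "adjacent u v" "u \<in> lbox M" "v \<in> lbox M" "{u, v} \<noteq> gate K j \<sigma>" for u v
  proof (cases "\<sigma> * v $ j \<le> \<sigma> * u $ j \<or> \<sigma> * v $ j \<le> t")
    case True
    then have "\<phi> v \<le> \<phi> u"
      unfolding \<phi>_def by (intro sum_mono2) (auto simp: c0)
    then show ?thesis using nonneg[OF lattice_edgesI[OF uv(1)]] by linarith
  next
    case False
    obtain i where i: "\<bar>v $ i - u $ i\<bar> = 1" "\<And>j. j \<noteq> i \<Longrightarrow> v $ j = u $ j"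
      using adjacent_cases[OF uv(1)] by blast
    have "i = j" using i(2)[of j] False by force
    define r where "r = \<sigma> * u $ j"
    have vr: "\<sigma> * v $ j = r + 1" and r: "t \<le> r"
      using i(1) \<open>i = j\<close> False \<sigma> by (auto simp: r_def)
    have "{t..<r + 1} = insert r {t..<r}" using r by auto
    then have d: "\<phi> v - \<phi> u = c r" by (simp add: \<phi>_def vr flip: r_def)
    have rM: "r < M" "\<bar>v $ j\<bar> = r + 1"
      using uv(3) vr \<sigma> r assms(6) scales by (auto simp: lbox_def dest!: spec[of _ j])
    have out: "\<not> (u \<in> lbox n \<and> v \<in> lbox n)"
      using rM r assms(6) by (auto simp: lbox_def dest!: spec[of _ j])
    show ?thesis
    proof (cases "u = axis j (u $ j)")
      case True
      then have u: "u = axis j (\<sigma> * r)" using \<sigma> by (auto simp: r_def)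
      have "v $ l = (axis j (\<sigma> * (r + 1)) :: int ^ 'd) $ l" for l
      proof (cases "l = j")
        case True
        then show ?thesis using vr \<sigma> by (auto simp: axis_def)
      next
        case False
        then show ?thesis using i(2)[of l] \<open>i = j\<close> u by (simp add: axis_def)
      qed
      then have v: "v = axis j (\<sigma> * (r + 1))" by (simp add: vec_eq_iff)
      have "r \<noteq> K" using uv(4) u v by (auto simp: gate_def)
      then show ?thesis using d u v by (simp add: c_def h_def)
    next
      case False
      \<comment> \<open>An edge in direction \<open>j\<close> off the \<open>j\<close>-axis lies on
        no axis, since on any other axis the \<open>j\<close>-coordinate is constantly 0.\<close>
      have "\<forall>l s t. {u, v} \<noteq> {axis l s, axis l t}"
      proof (intro allI notI)
        fix l s t assume e: "{u, v} = {axis l s, axis l t}"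
        then have ul: "\<exists>s. u = axis l s" and vl: "\<exists>s. v = axis l s" by (auto simp: doubleton_eq_iff)
        have "l \<noteq> j" using ul False by (auto simp: axis_nth)
        then have "u $ j = 0" "v $ j = 0" using ul vl by (auto simp: axis_def)
        then show False using i(1) \<open>i = j\<close> by simp
      qed
      then have "\<beta> \<le> \<omega> {u, v}" using slow uv out by blast
      moreover have "c r \<le> \<beta>" using h\<alpha>[of r] r rM assms(6) levels by (auto simp: c_def)
      ultimately show ?thesis using d by linarith
    qed
  qed
  have "\<phi> (\<gamma> k1) - \<phi> (\<gamma> k0) \<le> (\<Sum>k=k0..<k1. \<omega> {\<gamma> k, \<gamma> (Suc k)})"
  proof (rule potential_le_time[OF assms(3)], rule step)
    fix k assume k: "k0 \<le> k" "k < k1"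
    show "adjacent (\<gamma> k) (\<gamma> (Suc k))" using assms(1) by (simp add: geodesic_ray_def)
    show "{\<gamma> k, \<gamma> (Suc k)} \<noteq> gate K j \<sigma>" using no by (auto simp: ray_edges_def)
  qed (use assms(4) in auto)
  \<comment> \<open>Staying on the highway costs the sum of \<open>h\<close>, whereas the potential
    rises by the sum of \<open>c\<close>. They differ by \<open>\<beta> - h K\<close>, which is
    positive because \<open>h K\<close> is at most \<open>\<alpha>\<close>.\<close>
  also have "\<dots> \<le> 0 + (\<Sum>r\<in>{t..<s}. h r)"
    unfolding h_def
    by (rule geodesic_ray_time_le[OF nonneg assms(1,3)])
      (use reach_axis[OF reach_refl assms(2), where t = t and s = s] assms in auto)
  also have "\<phi> (\<gamma> k1) - \<phi> (\<gamma> k0) = (\<Sum>r\<in>{t..<s}. c r)"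
    using \<sigma> assms(5,8) by (auto simp: \<phi>_def)
  also have "\<dots> = (\<Sum>r\<in>{t..<s}. h r + (if r = K then \<beta> - h K else 0))"
    by (rule sum.cong) (auto simp: c_def)
  also have "\<dots> = (\<Sum>r\<in>{t..<s}. h r) + (\<beta> - h K)"
    using assms by (simp add: sum.distrib)
  finally show False using h\<alpha>[of K] scales levels by auto
qed

text \<open>Walk inside the small box to the highway vertex at distance \<open>n\<close>, then
  follow the highway.\<close>

lemma reach_highway:
  assumes "x \<in> lbox n" "\<bar>\<sigma>\<bar> = 1" "n \<le> t" "t \<le> M"
  shows "reach \<omega> x (axis j (\<sigma> * t)) (C * (2 * n * CARD('d)) + \<alpha> * (t - n))"
proof -
  define D where "D = (\<Sum>i\<in>UNIV. \<bar>x $ i - axis j (\<sigma> * n) $ i\<bar>)"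
  define S where "S = (\<Sum>r\<in>{n..<t}. \<omega> {axis j (\<sigma> * r), axis j (\<sigma> * (r + 1))})"
  have xi: "\<bar>x $ i\<bar> \<le> n" for i using assms(1) by (simp add: lbox_def)
  have ai: "\<bar>(axis j (\<sigma> * n) :: int ^ 'd) $ i\<bar> \<le> n" for i
    using assms(2) scales by (auto simp: axis_def abs_mult)
  have "reach \<omega> x (axis j (\<sigma> * n)) (0 + C * real_of_int D)"
    unfolding D_def
  proof (rule reach_cuboid[OF reach_refl, where lo = "\<lambda>_. -n" and hi = "\<lambda>_. n"])
    show "-n \<le> x $ i \<and> x $ i \<le> n" for i using xi[of i] by auto
    show "-n \<le> axis j (\<sigma> * n) $ i \<and> axis j (\<sigma> * n) $ i \<le> n" for i using ai[of i] by auto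
    show "\<omega> {p, q} \<le> C" if "adjacent p q" "\<And>i. - n \<le> p $ i \<and> p $ i \<le> n"
      "\<And>i. - n \<le> q $ i \<and> q $ i \<le> n" for p q
      using that by (intro inner) (auto simp: lbox_def abs_le_iff minus_le_iff)
  qed
  then have "reach \<omega> x (axis j (\<sigma> * t)) (0 + C * real_of_int D + S)"
    unfolding S_def using assms by (intro reach_axis) auto
  moreover have "D \<le> (\<Sum>i\<in>(UNIV :: 'd set). 2 * n)"
    unfolding D_def
  proof (rule sum_mono)
    show "\<bar>x $ i - axis j (\<sigma> * n) $ i\<bar> \<le> 2 * n" for i using xi[of i] ai[of i] by linarith
  qed
  then have "D \<le> 2 * n * int CARD('d)" by (simp add: mult.commute)
  then have "real_of_int D \<le> real_of_int (2 * n * int CARD('d))" by linarith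
  then have "C * real_of_int D \<le> C * (2 * n * CARD('d))"
    using levels by (intro mult_left_mono) auto
  moreover have "S \<le> (\<Sum>r\<in>{n..<t}. \<alpha>)"
    unfolding S_def by (rule sum_mono) (use fast_axis assms in auto)
  then have "S \<le> \<alpha> * (t - n)" using assms by (simp add: mult.commute)
  ultimately show ?thesis
    unfolding reach_def by (smt (verit) of_int_diff)
qed

text \<open>The potential vanishes on the small box and grows by \<open>\<beta>\<close> with each step in direction \<open>j\<close>
  outside of it, as long as the highway is avoided.\<close>

lemma first_highway_visit:
  assumes "geodesic_ray \<omega> \<gamma>" "\<gamma> 0 \<in> lbox n" "\<bar>\<sigma>\<bar> = 1" "\<And>k. k \<le> k0 \<Longrightarrow> \<gamma> k \<in> lbox M"
    and "\<gamma> k0 = axis j (\<sigma> * t)" "n \<le> t" "\<And>k t. k < k0 \<Longrightarrow> n \<le> t \<Longrightarrow> \<gamma> k \<noteq> axis j (\<sigma> * t)"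
  shows "t \<le> K"
proof (rule ccontr)
  assume tK: "\<not> t \<le> K"
  have \<sigma>: "\<sigma> = 1 \<or> \<sigma> = -1" using assms(3) by auto
  have tM: "t \<le> M" using assms(4)[of k0] assms(5) scales \<sigma> by auto
  define \<phi> :: "int ^ 'd \<Rightarrow> real" where "\<phi> u = \<beta> * real_of_int (max 0 (\<sigma> * u $ j - n))" for u
  \<comment> \<open>Only the tail \<open>u\<close> must be off the half-axis, as the last step of
    the ray ends on it. This suffices: a rising step along the axis would have its tail on the
    half-axis at distance at least \<open>n\<close>.\<close>
  have step: "\<phi> v - \<phi> u \<le> \<omega> {u, v}"
    if uv: "adjacent u v" "u \<in> lbox M" "v \<in> lbox M" "\<forall>t\<ge>n. u \<noteq> axis j (\<sigma> * t)" for u v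
  proof (cases "\<sigma> * v $ j \<le> \<sigma> * u $ j \<or> \<sigma> * v $ j \<le> n")
    case True
    then have "\<phi> v \<le> \<phi> u"
      unfolding \<phi>_def using levels by (intro mult_left_mono) auto
    then show ?thesis using nonneg[OF lattice_edgesI[OF uv(1)]] by linarith
  next
    case False
    obtain i where i: "\<bar>v $ i - u $ i\<bar> = 1" "\<And>j. j \<noteq> i \<Longrightarrow> v $ j = u $ j"
      using adjacent_cases[OF uv(1)] by blast
    have "i = j" using i(2)[of j] False by force
    have vr: "\<sigma> * v $ j = \<sigma> * u $ j + 1" and r: "n \<le> \<sigma> * u $ j"
      using i(1) \<open>i = j\<close> False \<sigma> by auto
    have d: "\<phi> v - \<phi> u = \<beta>" using r by (simp add: \<phi>_def vr algebra_simps)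
    have out: "\<not> (u \<in> lbox n \<and> v \<in> lbox n)"
      using r vr \<sigma> by (auto simp: lbox_def dest!: spec[of _ j])
    have "\<forall>l s t. {u, v} \<noteq> {axis l s, axis l t}"
    proof (intro allI notI)
      fix l s t assume e: "{u, v} = {axis l s, axis l t}"
      then have ul: "\<exists>s. u = axis l s" and vl: "\<exists>s. v = axis l s" by (auto simp: doubleton_eq_iff)
      show False
      proof (cases "l = j")
        case True
        then have "u = axis j (\<sigma> * (\<sigma> * u $ j))" using ul \<sigma> by (auto simp: axis_nth)
        then show False using uv(4) r by blast
      next
        case False
        then have "u $ j = 0" "v $ j = 0" using ul vl by (auto simp: axis_def)
        then show False using i(1) \<open>i = j\<close> by simp
      qed
    qed
    then show ?thesis using slow uv out d by simp
  qed
  have "\<phi> (\<gamma> k0) - \<phi> (\<gamma> 0) \<le> (\<Sum>k=0..<k0. \<omega> {\<gamma> k, \<gamma> (Suc k)})"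
  proof (rule potential_le_time, simp, rule step)
    fix k assume k: "0 \<le> k" "k < k0"
    show "adjacent (\<gamma> k) (\<gamma> (Suc k))" using assms(1) by (simp add: geodesic_ray_def)
    show "\<forall>t\<ge>n. \<gamma> k \<noteq> axis j (\<sigma> * t)" using k assms(7) by blast
  qed (use assms(4) in auto)
  also have "\<dots> \<le> C * (2 * n * CARD('d)) + \<alpha> * (t - n)"
    by (rule geodesic_ray_time_le[OF nonneg assms(1)])
      (use reach_highway[OF assms(2,3,6) tM] assms(5) in auto)
  also have "\<phi> (\<gamma> k0) = \<beta> * (t - n)"
    using \<sigma> assms(5,6) by (auto simp: \<phi>_def)
  also have "\<phi> (\<gamma> 0) = 0"
    using assms(2) \<sigma> by (auto simp: \<phi>_def lbox_def max_def dest!: spec[of _ j])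
  \<comment> \<open>The ray needs at least \<open>\<beta>\<close> per unit of distance, the
    competing path only \<open>\<alpha>\<close> after its detour; beyond \<open>K\<close> this
    contradicts \<open>K_large\<close>.\<close>
  finally have "(\<beta> - \<alpha>) * (t - n) \<le> C * (2 * n * CARD('d))" by (simp add: algebra_simps)
  moreover have "(\<beta> - \<alpha>) * real_of_int (K - n) \<le> (\<beta> - \<alpha>) * (t - n)"
    using tK levels by (intro mult_left_mono) auto
  ultimately show False using K_large by linarith
qed

text \<open>Off the highways beyond distance \<open>K\<close>, \<open>\<beta>\<close> times the \<open>l\<^sub>1\<close>-distance to the box of radius \<open>K\<close>
  is a potential.  The competing path uses a highway up to distance \<open>M\<close> and then stays in the
  face of the large box.\<close>

lemma exit_uses_highway:
  assumes "geodesic_ray \<omega> \<gamma>" "\<gamma> 0 \<in> lbox n" "\<And>k. k \<le> N \<Longrightarrow> \<gamma> k \<in> lbox M" "\<bar>\<gamma> N $ i\<bar> = M"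
  shows "\<exists>k\<le>N. \<exists>j \<sigma> s. \<bar>\<sigma>\<bar> = 1 \<and> K < s \<and> \<gamma> k = axis j (\<sigma> * s)"
proof (rule ccontr)
  assume no: "\<not> ?thesis"
  have no: "\<gamma> k \<noteq> axis j s" if "k \<le> N" "K < \<bar>s\<bar>" for k j s
  proof
    assume "\<gamma> k = axis j s"
    then have "\<gamma> k = axis j (sgn s * \<bar>s\<bar>)" "\<bar>sgn s\<bar> = 1"
      using that scales by (auto simp: mult_sgn_abs abs_sgn_eq)
    then show False using no that by blast
  qed
  define g where "g a = max 0 (\<bar>a\<bar> - K)" for a
  define \<phi> :: "int ^ 'd \<Rightarrow> real" where "\<phi> u = \<beta> * real_of_int (\<Sum>l\<in>UNIV. g (u $ l))" for u
  have step: "\<phi> v - \<phi> u \<le> \<omega> {u, v}"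
    \<comment> \<open>Here the head \<open>v\<close> must be off the highways: a step raising the
      potential ends beyond distance \<open>K\<close> in some coordinate, so if its edge were on an
      axis, \<open>v\<close> would be a highway vertex beyond \<open>K\<close>.\<close>
    if uv: "adjacent u v" "u \<in> lbox M" "v \<in> lbox M" "\<forall>j s. K < \<bar>s\<bar> \<longrightarrow> v \<noteq> axis j s" for u v
  proof -
    obtain i where i: "\<bar>v $ i - u $ i\<bar> = 1" "\<And>j. j \<noteq> i \<Longrightarrow> v $ j = u $ j"
      using adjacent_cases[OF uv(1)] by blast
    have "(\<Sum>l\<in>UNIV. g (v $ l)) = (\<Sum>l\<in>UNIV. g (u $ l) + (if l = i then g (v $ i) - g (u $ i) else 0))"
      by (rule sum.cong) (use i in auto)
    then have d: "\<phi> v - \<phi> u = \<beta> * real_of_int (g (v $ i) - g (u $ i))"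
      by (simp add: \<phi>_def sum.distrib distrib_left right_diff_distrib del: of_int_sum)
    show ?thesis
    proof (cases "g (v $ i) \<le> g (u $ i)")
      case True
      then have "\<phi> v - \<phi> u \<le> 0" unfolding d using levels by (intro mult_nonneg_nonpos) auto
      then show ?thesis using nonneg[OF lattice_edgesI[OF uv(1)]] by linarith
    next
      case False
      have "\<beta> * real_of_int (g (v $ i) - g (u $ i)) \<le> \<beta> * 1"
        using levels i(1) by (intro mult_left_mono) (auto simp: g_def)
      then have d: "\<phi> v - \<phi> u \<le> \<beta>" using d by simp
      have vK: "\<bar>v $ i\<bar> > K" using False by (auto simp: g_def max_def split: if_splits)
      have out: "\<not> (u \<in> lbox n \<and> v \<in> lbox n)"
        using vK scales by (auto simp: lbox_def dest!: spec[of _ i])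
      have "\<forall>l s t. {u, v} \<noteq> {axis l s, axis l t}"
      proof (intro allI notI)
        fix l s t assume e: "{u, v} = {axis l s, axis l t}"
        then obtain s where s: "v = axis l s" by (auto simp: doubleton_eq_iff)
        then have "K < \<bar>s\<bar>" using vK scales by (auto simp: axis_def split: if_splits)
        then show False using uv(4) s by blast
      qed
      then show ?thesis using slow uv out d by (smt (verit))
    qed
  qed
  define y where "y = \<gamma> N"
  \<comment> \<open>The length of the competing path's second leg, from the axis point of the exit
    face to \<open>y\<close>.\<close>
  define Q where "Q = (\<Sum>l\<in>UNIV - {i}. \<bar>y $ l\<bar>)"
  have yM: "\<bar>y $ l\<bar> \<le> M" for l using assms(3)[of N] by (simp add: y_def lbox_def)
  have yi: "\<bar>y $ i\<bar> = M" using assms(4) by (simp add: y_def)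
  have Q0: "0 \<le> Q" unfolding Q_def by (rule sum_nonneg) auto
  have "Q \<le> (\<Sum>l\<in>UNIV - {i}. M)" unfolding Q_def by (rule sum_mono) (rule yM)
  also have "\<dots> \<le> (\<Sum>l\<in>(UNIV :: 'd set). M)" by (rule sum_mono2) (use scales in auto)
  finally have Q1: "Q \<le> int CARD('d) * M" by simp
  have tot: "(\<Sum>l\<in>UNIV. \<bar>y $ l\<bar>) = M + Q"
    unfolding Q_def yi[symmetric] by (rule sum.remove) auto
  have "\<phi> y - \<phi> (\<gamma> 0) \<le> (\<Sum>k=0..<N. \<omega> {\<gamma> k, \<gamma> (Suc k)})"
    unfolding y_def
  proof (rule potential_le_time, simp, rule step)
    fix k assume k: "0 \<le> k" "k < N"
    show "adjacent (\<gamma> k) (\<gamma> (Suc k))" using assms(1) by (simp add: geodesic_ray_def)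
    show "\<forall>j s. K < \<bar>s\<bar> \<longrightarrow> \<gamma> (Suc k) \<noteq> axis j s" using k no by simp
  qed (use assms(3) in auto)
  also have "\<dots> \<le> C * (2 * n * CARD('d)) + \<alpha> * (M - n) + \<beta>' * Q"
  proof (rule geodesic_ray_time_le[OF nonneg assms(1)])
    define \<sigma> where "\<sigma> = sgn (y $ i)"
    have \<sigma>: "\<bar>\<sigma>\<bar> = 1" "\<sigma> * M = y $ i"
      using yi scales by (auto simp: \<sigma>_def abs_sgn_eq) (metis sgn_mult_abs)
    have "reach \<omega> (\<gamma> 0) (axis i (\<sigma> * M)) (C * (2 * n * CARD('d)) + \<alpha> * (M - n))"
      by (rule reach_highway) (use assms \<sigma> scales in auto)
    then have "reach \<omega> (\<gamma> 0) y (C * (2 * n * CARD('d)) + \<alpha> * (M - n) +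
        \<beta>' * real_of_int (\<Sum>l\<in>UNIV. \<bar>axis i (\<sigma> * M) $ l - y $ l\<bar>))"
    \<comment> \<open>Coordinate \<open>i\<close> is pinned to \<open>y $ i\<close>, of absolute
      value \<open>M > n\<close>. The walk thus stays in the face and meets only edges outside the
      small box, each of time at most \<open>\<beta>'\<close>.\<close>
    proof (rule reach_cuboid[where lo = "\<lambda>l. if l = i then y $ i else - M"
          and hi = "\<lambda>l. if l = i then y $ i else M"])
      show "(if l = i then y $ i else - M) \<le> axis i (\<sigma> * M) $ l \<and>
         axis i (\<sigma> * M) $ l \<le> (if l = i then y $ i else M)" for l
        using \<sigma> scales by (auto simp: axis_def)
      show "(if l = i then y $ i else - M) \<le> y $ l \<and> y $ l \<le> (if l = i then y $ i else M)" for l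
        using yM[of l] by auto
      fix p q :: "int ^ 'd"
      assume pq: "adjacent p q"
        "\<And>l. (if l = i then y $ i else - M) \<le> p $ l \<and> p $ l \<le> (if l = i then y $ i else M)"
        "\<And>l. (if l = i then y $ i else - M) \<le> q $ l \<and> q $ l \<le> (if l = i then y $ i else M)"
      have "\<bar>p $ l\<bar> \<le> M" "\<bar>q $ l\<bar> \<le> M" for l
        using pq(2,3)[of l] yi by (auto split: if_splits)
      moreover have "p $ i = y $ i" using pq(2)[of i] by auto
      then have "p \<notin> lbox n" using yi scales by (auto simp: lbox_def intro!: exI[of _ i])
      ultimately show "\<omega> {p, q} \<le> \<beta>'" by (intro outer pq) (auto simp: lbox_def)
    qed
    moreover have "(\<Sum>l\<in>UNIV. \<bar>axis i (\<sigma> * M) $ l - y $ l\<bar>) = Q"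
    proof -
      have "(\<Sum>l\<in>UNIV. \<bar>axis i (\<sigma> * M) $ l - y $ l\<bar>) =
          \<bar>axis i (\<sigma> * M) $ i - y $ i\<bar> + (\<Sum>l\<in>UNIV - {i}. \<bar>axis i (\<sigma> * M) $ l - y $ l\<bar>)"
        by (rule sum.remove) auto
      also have "\<dots> = Q" unfolding Q_def using \<sigma> by (auto simp: axis_def intro!: sum.cong)
      finally show ?thesis .
    qed
    ultimately show "reach \<omega> (\<gamma> 0) (\<gamma> N) (C * (2 * n * CARD('d)) + \<alpha> * (M - n) + \<beta>' * Q)"
      by (simp add: y_def del: of_int_sum)
  qed auto
  also have "\<phi> (\<gamma> 0) = 0"
  proof -
    have "g (\<gamma> 0 $ l) = 0" for l
      using assms(2) scales by (auto simp: lbox_def g_def max_def dest!: spec[of _ l])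
    then show ?thesis by (simp add: \<phi>_def)
  qed
  finally have le: "\<phi> y \<le> C * (2 * n * CARD('d)) + \<alpha> * (M - n) + \<beta>' * Q" by simp
  have "(\<Sum>l\<in>UNIV. \<bar>y $ l\<bar> - K) \<le> (\<Sum>l\<in>UNIV. g (y $ l))"
    by (rule sum_mono) (auto simp: g_def)
  then have "M + Q - K * int CARD('d) \<le> (\<Sum>l\<in>UNIV. g (y $ l))"
    by (simp add: sum_subtractf tot mult.commute)
  then have "real_of_int (M + Q - K * int CARD('d)) \<le> real_of_int (\<Sum>l\<in>UNIV. g (y $ l))"
    by (simp only: of_int_le_iff)
  then have "\<beta> * (M + Q - K * int CARD('d)) \<le> \<phi> y"
    unfolding \<phi>_def using levels by (intro mult_left_mono) auto
  \<comment> \<open>The potential already gains \<open>\<beta> * Q\<close> against the cost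
    \<open>\<beta>' * Q\<close> of the second leg, so only this difference has to be absorbed by
    \<open>M_large\<close>.\<close>
  moreover have "(\<beta>' - \<beta>) * Q \<le> (\<beta>' - \<beta>) * (int CARD('d) * M)"
    using levels Q1 by (intro mult_left_mono) (auto simp del: of_int_mult)
  moreover have "0 \<le> \<alpha> * n" using levels scales by simp
  ultimately show False using le M_large by (simp add: algebra_simps)
qed

text \<open>Injectivity drives the ray out of the finite large box. All comparisons stop at the last
  vertex before the first exit, since times are controlled only inside the box.\<close>

lemma ray_uses_gate:
  assumes "geodesic_ray \<omega> \<gamma>" "\<gamma> 0 \<in> lbox n"
  shows "\<exists>j. \<exists>\<sigma>\<in>{1, -1}. gate K j \<sigma> \<in> ray_edges \<gamma>"
proof -
  have "\<exists>k. \<gamma> k \<notin> lbox M"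
  proof (rule ccontr)
    assume "\<not> ?thesis"
    then have "range \<gamma> \<subseteq> lbox M" by auto
    then have "finite (range \<gamma>)" using finite_lbox finite_subset by blast
    moreover have "inj \<gamma>" using assms(1) by (simp add: geodesic_ray_def)
    ultimately show False using finite_imageD by auto
  qed
  moreover have "\<gamma> 0 \<in> lbox M" using assms(2) lbox_mono[of n M] scales by auto
  ultimately obtain N where N: "\<forall>k\<le>N. \<gamma> k \<in> lbox M" "\<gamma> (Suc N) \<notin> lbox M"
    using ex_least_nat_less[of "\<lambda>k. \<gamma> k \<notin> lbox M"] by auto
  obtain i where i: "\<bar>\<gamma> (Suc N) $ i\<bar> > M" using N(2) by (auto simp: lbox_def not_le)
  have "adjacent (\<gamma> N) (\<gamma> (Suc N))" using assms(1) by (simp add: geodesic_ray_def)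
  then have "\<bar>\<gamma> (Suc N) $ i - \<gamma> N $ i\<bar> \<le> 1"
    by (elim adjacent_cases) (smt (verit))
  moreover have "\<bar>\<gamma> N $ i\<bar> \<le> M" using N(1) by (auto simp: lbox_def)
  ultimately have "\<bar>\<gamma> N $ i\<bar> = M" using i by linarith
  then obtain k j \<sigma> s where k: "k \<le> N" "\<bar>\<sigma>\<bar> = 1" "K < s" "\<gamma> k = axis j (\<sigma> * s)"
    using exit_uses_highway[OF assms] N(1) by blast
  \<comment> \<open>The first visit is sought from distance \<open>n\<close> on. It happens at some
    \<open>t\<close> with \<open>t \<le> K < s\<close>, so the gate lies between the two
    visits.\<close>
  define P where "P m \<longleftrightarrow> (\<exists>t\<ge>n. \<gamma> m = axis j (\<sigma> * t))" for m
  have Pk: "P k" using k scales by (auto simp: P_def intro!: exI[of _ s])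
  define k0 where "k0 = (LEAST m. P m)"
  have "P k0" "k0 \<le> k" unfolding k0_def using Pk by (auto intro: LeastI Least_le)
  then obtain t where t: "n \<le> t" "\<gamma> k0 = axis j (\<sigma> * t)" by (auto simp: P_def)
  have "t \<le> K"
  proof (rule first_highway_visit[OF assms k(2) _ t(2,1)])
    show "\<gamma> m \<in> lbox M" if "m \<le> k0" for m using that N(1) \<open>k0 \<le> k\<close> k by auto
    show "\<gamma> m \<noteq> axis j (\<sigma> * t)" if "m < k0" "n \<le> t" for m t
      using not_less_Least[of m P] that by (auto simp: k0_def P_def)
  qed
  then have "gate K j \<sigma> \<in> ray_edges \<gamma>"
    by (intro gate_used[OF assms(1) k(2) \<open>k0 \<le> k\<close> _ t(2,1) _ k(4,3)]) (use N(1) k in auto)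
  then show ?thesis using k(2) by (auto simp: abs_if split: if_splits)
qed

end


section \<open>Genericity\<close>

text \<open>The gates depend on \<open>U\<close> through \<open>K\<close>, but one set
  \<open>G\<close> serves all of the open set \<open>W\<close>. This makes the resulting property of
  configurations hold on a dense open set.\<close>

lemma gates_near_open_set:
  fixes U :: "('d::finite) config set" and n :: int
  assumes A: "A \<subseteq> {0..}" "a \<in> A" "b \<in> A" "a < b"
    and U: "openin (config_space A) U" "U \<noteq> {}" and n: "0 \<le> n"
  shows "\<exists>W G. openin (config_space A) W \<and> W \<noteq> {} \<and> W \<subseteq> U \<and>
    finite G \<and> card G \<le> 2 * CARD('d) \<and> (\<forall>e\<in>G. \<not> e \<subseteq> lbox n) \<and>
    (\<forall>\<omega>\<in>W. \<forall>\<gamma>. geodesic_ray \<omega> \<gamma> \<longrightarrow> \<gamma> 0 \<in> lbox n \<longrightarrow> G \<inter> ray_edges \<gamma> \<noteq> {})"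
proof -
  obtain \<omega>0 where "\<omega>0 \<in> U" using U by blast
  then obtain V where V: "finite {e \<in> lattice_edges. V e \<noteq> A}"
      "\<And>e. e \<in> lattice_edges \<Longrightarrow> openin (top_of_set A) (V e)"
      "\<omega>0 \<in> PiE lattice_edges V" "PiE lattice_edges V \<subseteq> U"
    using U(1)[unfolded config_space_def openin_product_topology_alt, rule_format, of \<omega>0] by auto
  \<comment> \<open>The basic neighbourhood restricts finitely many edges. Enlarging the box to
    contain them leaves every other edge free.\<close>
  have "finite (\<Union>{e \<in> lattice_edges. V e \<noteq> A} :: (int ^ 'd) set)"
    using V(1) by (auto simp: lattice_edges_def)
  then obtain n0 where n0: "n \<le> n0" "\<Union>{e \<in> lattice_edges. V e \<noteq> A} \<subseteq> (lbox n0 :: (int ^ 'd) set)"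
    using ex_lbox_superset by metis
  define D :: real where "D = CARD('d)"
  have D: "1 \<le> D" using zero_less_card_finite[where 'a = 'd] by (simp add: D_def)
  \<comment> \<open>With this value, \<open>\<beta> - \<alpha> - (\<beta>' - \<beta>) * D\<close>
    equals \<open>(b - a) / 2\<close>, the positive rate needed for \<open>M_large\<close>.\<close>
  define \<delta> where "\<delta> = (b - a) / (4 * (D + 1))"
  have "\<delta> * (4 * (D + 1)) = b - a" using D by (simp add: \<delta>_def)
  moreover have "0 < \<delta>" using A(4) D by (simp add: \<delta>_def)
  ultimately have \<delta>: "0 < \<delta>" "4 * \<delta> * D + 4 * \<delta> = b - a" by (auto simp: algebra_simps)
  have "\<delta> \<le> \<delta> * D" using \<delta> D by simp
  with \<delta> have \<delta>3: "8 * \<delta> \<le> b - a" by linarith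
  have a0: "0 \<le> a" using A by auto
  define \<alpha> \<beta> \<beta>' where "\<alpha> = a + \<delta>" and "\<beta> = b - \<delta>" and "\<beta>' = b + \<delta>"
  note levels = \<alpha>_def \<beta>_def \<beta>'_def
  \<comment> \<open>A crude sum dominating every single term; the summand 1 leaves open room above
    \<open>\<omega>0 e\<close>.\<close>
  define C where "C = (\<Sum>e\<in>Pow (lbox n0). \<bar>\<omega>0 e\<bar> + 1)"
  have C: "\<omega>0 e + 1 \<le> C" if "e \<subseteq> lbox n0" for e
  proof -
    have "\<bar>\<omega>0 e\<bar> + 1 \<le> C"
      unfolding C_def using that finite_lbox by (intro member_le_sum) auto
    then show ?thesis by linarith
  qed
  have C0: "0 \<le> C" unfolding C_def by (rule sum_nonneg) auto
  \<comment> \<open>\<open>K\<close> is chosen before \<open>M\<close>, because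
    \<open>M_large\<close> involves \<open>K\<close>.\<close>
  have "0 < \<beta> - \<alpha>" using \<delta> \<delta>3 by (simp add: levels)
  then obtain m :: nat where m: "C * (2 * n0 * CARD('d)) < m * (\<beta> - \<alpha>)"
    using reals_Archimedean3 by blast
  define K where "K = n0 + int m"
  have "0 < (b - a) / 2" using A by simp
  then obtain m' :: nat where m': "C * (2 * n0 * CARD('d)) + \<beta> * K * CARD('d) < m' * ((b - a) / 2)"
    using reals_Archimedean3 by blast
  define M where "M = K + int m' + 1"
  have KM: "0 \<le> n0" "n0 \<le> K" "K < M" using n n0(1) by (auto simp: K_def M_def)
  \<comment> \<open>Highways are bounded only from above, as \<open>A\<close> provides
    nonnegativity. Nonemptiness of \<open>W\<close> is witnessed by \<open>\<omega>0\<close> in the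
    small box, \<open>a\<close> on the highways and \<open>b\<close> elsewhere.\<close>
  define X where "X e = (if e \<subseteq> lbox n0 then {..<\<omega>0 e + 1} else if e \<subseteq> lbox M then
      (if \<exists>j s t. e = {axis j s, axis j t} then {..<\<alpha>} else {\<beta><..<\<beta>'}) else UNIV)" for e :: "(int ^ 'd) set"
  define W where "W = PiE lattice_edges (\<lambda>e. V e \<inter> X e)"
  have "openin (config_space A) W"
    unfolding W_def config_space_def openin_PiE_gen
  proof (intro disjI2 conjI ballI)
    have "{e \<in> lattice_edges. V e \<inter> X e \<noteq> topspace (top_of_set A)} \<subseteq>
        {e \<in> lattice_edges. V e \<noteq> A} \<union> Pow (lbox n0) \<union> Pow (lbox M)"
      by (auto simp: X_def)
    then show "finite {e \<in> lattice_edges. V e \<inter> X e \<noteq> topspace (top_of_set A)}"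
      by (rule finite_subset) (use V(1) finite_lbox in auto)
    show "openin (top_of_set A) (V e \<inter> X e)" if "e \<in> lattice_edges" for e
      by (rule openin_Int_open[OF V(2)[OF that]]) (auto simp: X_def)
  qed
  moreover have "W \<noteq> {}"
    unfolding W_def PiE_eq_empty_iff
  proof safe
    fix e :: "(int ^ 'd) set" assume e: "e \<in> lattice_edges" "V e \<inter> X e = {}"
    show False
    proof (cases "e \<subseteq> lbox n0")
      case True
      then have "\<omega>0 e \<in> V e \<inter> X e" using V(3) e(1) by (auto simp: X_def)
      then show False using e by auto
    next
      case False
      then have "V e = A" using n0(2) e(1) by auto
      then have "a \<in> V e" "b \<in> V e" using A by auto
      moreover have "a \<in> X e \<or> b \<in> X e" using False \<delta> by (auto simp: X_def levels)
      ultimately show False using e by auto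
    qed
  qed
  moreover have "W \<subseteq> U" using V(4) unfolding W_def by (blast intro: PiE_mono[THEN subsetD])
  moreover define G :: "(int ^ 'd) set set" where "G = (\<lambda>(j, \<sigma>). gate K j \<sigma>) ` (UNIV \<times> {1, -1})"
  have "finite G" unfolding G_def by (rule finite_imageI) auto
  moreover have "card G \<le> card ((UNIV :: 'd set) \<times> {1, -1 :: int})"
    unfolding G_def by (rule card_image_le) auto
  then have "card G \<le> 2 * CARD('d)" by (simp add: card_cartesian_product)
  moreover have "\<not> e \<subseteq> lbox n" if "e \<in> G" for e
    using that n n0(1) by (auto simp: G_def gate_def K_def)
  moreover have "G \<inter> ray_edges \<gamma> \<noteq> {}"
    if "\<omega> \<in> W" "geodesic_ray \<omega> \<gamma>" "\<gamma> 0 \<in> lbox n" for \<omega> \<gamma>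
  proof -
    have in_A: "\<omega> e \<in> A" and in_X: "\<omega> e \<in> X e" if "e \<in> lattice_edges" for e
      using \<open>\<omega> \<in> W\<close> V(2)[OF that] that by (auto simp: W_def PiE_iff dest!: openin_imp_subset)
    interpret highways \<omega> n0 K M C \<alpha> \<beta> \<beta>'
    proof
      show "0 \<le> \<omega> e" if "e \<in> lattice_edges" for e using in_A[OF that] A by auto
      show "0 \<le> n0" "n0 \<le> K" "K < M" "0 \<le> C" by fact+
      show "0 \<le> \<alpha>" "\<alpha> < \<beta>" "\<beta> \<le> \<beta>'" using \<delta> \<delta>3 a0 by (auto simp: levels)
      show "C * real_of_int (2 * n0 * int CARD('d)) < (\<beta> - \<alpha>) * real_of_int (K - n0)"
        using m by (simp add: K_def mult.commute)
      have "m' * ((b - a) / 2) \<le> M * ((b - a) / 2)"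
        using A KM by (intro mult_right_mono) (auto simp: M_def)
      then have "C * real_of_int (2 * n0 * int CARD('d)) + \<beta> * real_of_int K * real CARD('d)
          < (b - a) / 2 * real_of_int M"
        using m' by (simp only: mult.commute[of "(b - a) / 2"] of_int_of_nat_eq)
      moreover have "\<beta> - \<alpha> - (\<beta>' - \<beta>) * real CARD('d) = (b - a) / 2"
        using \<delta>(2) by (simp add: levels D_def algebra_simps)
      ultimately show "C * real_of_int (2 * n0 * int CARD('d)) + \<beta> * real_of_int K * real CARD('d)
          < (\<beta> - \<alpha> - (\<beta>' - \<beta>) * real CARD('d)) * real_of_int M"
        by (simp only:)
    next
      fix u v :: "int ^ 'd" assume uv: "adjacent u v" "u \<in> lbox n0" "v \<in> lbox n0"
      then show "\<omega> {u, v} \<le> C"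
        using in_X[OF lattice_edgesI[OF uv(1)]] C[of "{u, v}"] by (auto simp: X_def)
    next
      fix u v :: "int ^ 'd"
      assume uv: "adjacent u v" "u \<in> lbox M" "v \<in> lbox M" "\<not> (u \<in> lbox n0 \<and> v \<in> lbox n0)"
      show "\<omega> {u, v} \<le> \<beta>'"
        using in_X[OF lattice_edgesI[OF uv(1)]] uv \<delta> A(4)
        by (auto simp: X_def levels split: if_splits)
      show "\<beta> \<le> \<omega> {u, v}" if "\<forall>j s t. {u, v} \<noteq> {axis j s, axis j t}"
        using in_X[OF lattice_edgesI[OF uv(1)]] uv that by (auto simp: X_def)
    next
      fix j s t
      assume "adjacent (axis j s :: int ^ 'd) (axis j t)" "axis j s \<in> (lbox M :: (int ^ 'd) set)"
        "axis j t \<in> (lbox M :: (int ^ 'd) set)"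
        "\<not> (axis j s \<in> (lbox n0 :: (int ^ 'd) set) \<and> axis j t \<in> (lbox n0 :: (int ^ 'd) set))"
      moreover from this have "\<omega> {axis j s, axis j t} \<in> {..<\<alpha>}"
        using in_X[OF lattice_edgesI, of "axis j s" "axis j t"] unfolding X_def
        by (smt (verit, best) empty_subsetI insert_subset)
      ultimately show "\<omega> {axis j s, axis j t} \<le> \<alpha>" by simp
    qed
    have "\<gamma> 0 \<in> lbox n0" using that(3) lbox_mono[OF n0(1)] by auto
    then show ?thesis using ray_uses_gate[OF that(2)] by (auto simp: G_def)
  qed
  ultimately show ?thesis by blast
qed

section \<open>From dense open sets to the residual set\<close>

lemma nowhere_dense_in_complement:
  assumes "openin X V" "\<And>U. openin X U \<Longrightarrow> U \<noteq> {} \<Longrightarrow> U \<inter> V \<noteq> {}"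
  shows "nowhere_dense_in X (topspace X - V)"
proof -
  have "X closure_of (topspace X - V) = topspace X - V"
    using assms(1) by (simp add: closure_of_eq closedin_diff)
  moreover have "X interior_of (topspace X - V) = {}"
    using assms(2)[of "X interior_of (topspace X - V)"] interior_of_subset[of X "topspace X - V"]
    by auto
  ultimately show ?thesis by (simp add: nowhere_dense_in_def)
qed

theorem theorem1p3:
  fixes A :: "real set"
  assumes "A \<subseteq> {0..}"
    and "\<exists>a\<in>A. \<exists>b\<in>A. a \<noteq> b"
  shows "\<exists>R :: ('d::finite) config set. residual_in (config_space A) R \<and>
    (\<forall>\<omega>\<in>R. \<not> (\<exists>F. F \<subseteq> {\<gamma>. geodesic_ray \<omega> \<gamma>} \<and>
        card F = 4 * CARD('d)\<^sup>2 + 1 \<and> pairwise distinct_rays F))"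
proof -
  obtain a b where ab: "a \<in> A" "b \<in> A" "a < b" using assms(2) by (metis linorder_less_linear)
  let ?X = "config_space A :: 'd config topology"
  define P :: "nat \<Rightarrow> 'd config \<Rightarrow> bool" where
    "P n \<omega> \<longleftrightarrow> (\<exists>G. finite G \<and> card G \<le> 2 * CARD('d) \<and> (\<forall>e\<in>G. \<not> e \<subseteq> lbox (int n)) \<and>
      (\<forall>\<gamma>. geodesic_ray \<omega> \<gamma> \<longrightarrow> \<gamma> 0 \<in> lbox (int n) \<longrightarrow> G \<inter> ray_edges \<gamma> \<noteq> {}))" for n \<omega>
  \<comment> \<open>Taking the interior makes \<open>V n\<close> open by construction; it is dense
    because it contains the set \<open>W\<close> found inside each nonempty open set.\<close>
  define V where "V n = ?X interior_of Collect (P n)" for n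
  define R where "R = topspace ?X \<inter> (\<Inter>n. V n)"
  have dense: "U \<inter> V n \<noteq> {}" if U: "openin ?X U" "U \<noteq> {}" for U n
  proof -
    obtain W G where W: "openin ?X W" "W \<noteq> {}" "W \<subseteq> U" and G: "finite G" "card G \<le> 2 * CARD('d)"
      "\<forall>e\<in>G. \<not> e \<subseteq> lbox (int n)"
      "\<forall>\<omega>\<in>W. \<forall>\<gamma>. geodesic_ray \<omega> \<gamma> \<longrightarrow> \<gamma> 0 \<in> lbox (int n) \<longrightarrow> G \<inter> ray_edges \<gamma> \<noteq> {}"
      using gates_near_open_set[OF assms(1) ab U, of "int n"] by auto
    have "W \<subseteq> Collect (P n)" using G unfolding P_def by blast
    then have "W \<subseteq> V n" unfolding V_def using W(1) by (rule interior_of_maximal)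
    then show ?thesis using W by auto
  qed
  have "topspace ?X - R = (\<Union>n. topspace ?X - V n)" by (auto simp: R_def)
  moreover have "nowhere_dense_in ?X (topspace ?X - V n)" for n
    by (rule nowhere_dense_in_complement[OF _ dense]) (simp_all add: V_def)
  ultimately have "residual_in ?X R"
    unfolding residual_in_def meager_in_def by (auto simp: R_def intro!: exI[of _ "\<lambda>n. topspace ?X - V n"])
  moreover have False
    if R: "\<omega> \<in> R" and F: "F \<subseteq> {\<gamma>. geodesic_ray \<omega> \<gamma>}" "card F = 4 * CARD('d)\<^sup>2 + 1" "pairwise distinct_rays F"
    for \<omega> F
  proof -
    \<comment> \<open>Infinite sets have \<open>card\<close> 0, so the positive cardinality forces
      finiteness.\<close>
    have finF: "finite F" using F(2) card.infinite by fastforce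
    define I where "I = (\<Union>\<gamma>\<in>F. \<Union>\<gamma>'\<in>F - {\<gamma>}. ray_edges \<gamma> \<inter> ray_edges \<gamma>')"
    have "finite I"
      unfolding I_def using finF F(3) by (intro finite_UN_I) (auto simp: pairwise_def distinct_rays_def)
    moreover have "finite e" if "e \<in> I" for e
      using that by (auto simp: I_def ray_edges_def)
    ultimately have "finite ((\<lambda>\<gamma>. \<gamma> 0) ` F \<union> \<Union>I)" using finF by auto
    then obtain n' where n': "0 \<le> n'" "(\<lambda>\<gamma>. \<gamma> 0) ` F \<union> \<Union>I \<subseteq> lbox n'"
      using ex_lbox_superset by metis
    define n where "n = nat n'"
    have n: "int n = n'" using n' by (simp add: n_def)
    have "\<omega> \<in> V n" using R by (auto simp: R_def)
    then have "P n \<omega>" unfolding V_def using interior_of_subset by fastforce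
    then obtain G where G: "finite G" "card G \<le> 2 * CARD('d)" "\<And>e. e \<in> G \<Longrightarrow> \<not> e \<subseteq> lbox n'"
      "\<And>\<gamma>. geodesic_ray \<omega> \<gamma> \<Longrightarrow> \<gamma> 0 \<in> lbox n' \<Longrightarrow> G \<inter> ray_edges \<gamma> \<noteq> {}"
      unfolding P_def n by blast
    have "\<exists>e. e \<in> G \<inter> ray_edges \<gamma>" if "\<gamma> \<in> F" for \<gamma>
      using G(4)[of \<gamma>] that F(1) n'(2) by auto
    then obtain f where f: "\<And>\<gamma>. \<gamma> \<in> F \<Longrightarrow> f \<gamma> \<in> G \<inter> ray_edges \<gamma>" by metis
    have "CARD('d) \<le> CARD('d)\<^sup>2" by (simp add: power2_eq_square)
    then have "card G < card F" using G(2) F(2) by linarith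
    then have "\<not> inj_on f F" using card_inj_on_le[of f F G] f G(1) by fastforce
    then obtain \<gamma> \<gamma>' where g: "\<gamma> \<in> F" "\<gamma>' \<in> F" "\<gamma> \<noteq> \<gamma>'" "f \<gamma> = f \<gamma>'" by (auto simp: inj_on_def)
    \<comment> \<open>A gate shared by two rays of the family is a common edge, hence inside the
      box, whereas no gate is.\<close>
    then have "f \<gamma> \<in> I" using f[of \<gamma>] f[of \<gamma>'] unfolding I_def by auto
    then have "f \<gamma> \<subseteq> lbox n'" using n'(2) by auto
    then show False using G(3) f[OF g(1)] by auto
  qed
  ultimately show ?thesis by blast
qed

end
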